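(* Let $ABC$ be a triangle, let $K$ be its complement map, and let $E_0$, $F_0$ be the midpoints of $CA$ and $AB$. The locus $\mathscr{L}_A$ of points $P$ (for which the generalized orthocenter $H$ of $P$ with respect to $ABC$ is defined and) such that $H=A$ is a subset of the conic $\overline{\mathcal{C}}_A$ through $B, C, E_0, F_0$ whose tangent at $B$ is the line $K^{-1}(AC)$ and whose tangent at $C$ is the line $K^{-1}(AB)$. Namely, $\mathscr{L}_A=\overline{\mathcal{C}}_A\setminus\{B,C,E_0,F_0\}$.
   Context: Work in the extended Euclidean plane (the Euclidean plane together with the line at infinity $l_\infty$). $ABC$ is an ordinary (non-degenerate) triangle with centroid $G$. The complement map $K$ is the homothety with center $G$ and ratio $-1/2$ (it fixes $l_\infty$ pointwise); $K^{-1}(ABC)$ is the anticomplementary triangle. The isotomic map $\iota$ with respect to $ABC$ is given in homogeneous barycentric coordinates by $(x,y,z)\mapsto(1/x,1/y,1/z)$. The generalized orthocenter $H$ is defined for points $P$ not lying on the extended sides of $ABC$ or of $K^{-1}(ABC)$. For such $P$ put $P'=\iota(P)$, $Q=K(P')$, and let $D=AP\cap BC$, $E=BP\cap CA$, $F=CP\cap AB$ be the traces of $P$, and $D_3,E_3,F_3$ the traces of $P'$ on $BC,CA,AB$. Then $H$ is the unique point such that the lines $HA,HB,HC$ are parallel to $QD,QE,QF$, respectively (when $H$ coincides with a vertex the corresponding condition is void). Equivalently, $H=K^{-1}\circ T_{P'}^{-1}\circ K(Q)$, where $T_{P'}$ is the unique affine map taking $A,B,C$ to $D_3,E_3,F_3$,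 respectively. *)

theory Defs
  imports "HOL-Analysis.Analysis"
begin

text \<open>
  Points of the extended Euclidean plane, in homogeneous coordinates: a nonzero pair \<open>(v, t)\<close>,
  taken up to a nonzero factor, is the ordinary point \<open>v / t\<close> if \<open>t \<noteq> 0\<close>, and the point at
  infinity in the direction \<open>v\<close> if \<open>t = 0\<close>.
\<close>

definition hrel :: "(real^2) \<times> real \<Rightarrow> (real^2) \<times> real \<Rightarrow> bool" where
  "hrel p q \<longleftrightarrow> p \<noteq> 0 \<and> q \<noteq> 0 \<and> (\<exists>c. c \<noteq> 0 \<and> q = c *\<^sub>R p)"

lemma part_equivp_hrel: "part_equivp hrel"
proof (rule part_equivpI)
  show "\<exists>p. hrel p p"
    unfolding hrel_def by (intro exI[of _ "(0, 1)"] conjI exI[of _ 1]) (auto simp: zero_prod_def)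
  show "symp hrel"
  proof (rule sympI)
    fix p q assume "hrel p q"
    then obtain c where "p \<noteq> 0" "q \<noteq> 0" "c \<noteq> 0" "q = c *\<^sub>R p"
      by (auto simp: hrel_def)
    then show "hrel q p"
      unfolding hrel_def by (intro conjI exI[of _ "inverse c"]) auto
  qed
  show "transp hrel"
  proof (rule transpI)
    fix p q r assume "hrel p q" "hrel q r"
    then obtain c d where "p \<noteq> 0" "r \<noteq> 0" "c \<noteq> 0" "d \<noteq> 0" "q = c *\<^sub>R p" "r = d *\<^sub>R q"
      by (auto simp: hrel_def)
    then show "hrel p r"
      unfolding hrel_def by (intro conjI exI[of _ "d * c"]) auto
  qed
qed

quotient_type epoint = "(real^2) \<times> real" / partial: hrel
  by (rule part_equivp_hrel)

lift_definition fin_pt :: "real^2 \<Rightarrow> epoint" is "\<lambda>X. (X, 1)"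
  by (auto simp: hrel_def zero_prod_def intro: exI[of _ 1])

lift_definition at_inf :: "epoint \<Rightarrow> bool" is "\<lambda>p. snd p = 0"
  by (auto simp: hrel_def)

lemma span_pair_scale:
  assumes "c \<noteq> 0" "d \<noteq> 0"
  shows "span {c *\<^sub>R p, d *\<^sub>R q} = span {p, q :: 'a :: real_vector}"
proof -
  have *: "c *\<^sub>R p \<in> span {p, q}" "d *\<^sub>R q \<in> span {p, q}"
    by (auto intro: span_scale span_base)
  have "inverse c *\<^sub>R (c *\<^sub>R p) \<in> span {c *\<^sub>R p, d *\<^sub>R q}"
       "inverse d *\<^sub>R (d *\<^sub>R q) \<in> span {c *\<^sub>R p, d *\<^sub>R q}"
    by (rule span_scale, simp add: span_base)+
  with assms have "p \<in> span {c *\<^sub>R p, d *\<^sub>R q}" "q \<in> span {c *\<^sub>R p, d *\<^sub>R q}"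
    by auto
  with * show ?thesis
    by (intro antisym span_minimal) auto
qed

lift_definition on_line :: "epoint \<Rightarrow> epoint \<Rightarrow> epoint \<Rightarrow> bool"
  is "\<lambda>p q x. x \<in> span {p, q}"
proof -
  fix p p' q q' x x'
  assume "hrel p p'" "hrel q q'" "hrel x x'"
  then obtain a b c where "a \<noteq> 0" "b \<noteq> 0" "c \<noteq> 0"
      and [simp]: "p' = a *\<^sub>R p" "q' = b *\<^sub>R q" "x' = c *\<^sub>R x"
    by (auto simp: hrel_def)
  moreover from \<open>c \<noteq> 0\<close> have "x \<in> span {p, q} \<longleftrightarrow> c *\<^sub>R x \<in> span {p, q}"
    using span_scale[of x "{p, q}" c] span_scale[of "c *\<^sub>R x" "{p, q}" "inverse c"] by auto
  ultimately show "(x \<in> span {p, q}) = (x' \<in> span {p', q'})"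
    by (simp add: span_pair_scale)
qed

text \<open>The line joining two points, as a point set; only meaningful for \<open>P \<noteq> Q\<close>.\<close>

definition eline :: "epoint \<Rightarrow> epoint \<Rightarrow> epoint set" where
  "eline P Q = {X. on_line P Q X}"

definition meet :: "epoint set \<Rightarrow> epoint set \<Rightarrow> epoint" where
  "meet l m = (THE X. X \<in> l \<and> X \<in> m)"

text \<open>
  Parallelism of lines other than the line at infinity; a line is parallel to itself.
\<close>

definition parallel :: "epoint set \<Rightarrow> epoint set \<Rightarrow> bool" where
  "parallel l m \<longleftrightarrow> (\<exists>X. at_inf X \<and> X \<in> l \<and> X \<in> m)"

definition centroid :: "real^2 \<Rightarrow> real^2 \<Rightarrow> real^2 \<Rightarrow> real^2" where
  "centroid A B C = (1/3) *\<^sub>R (A + B + C)"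

text \<open>
  The complement map: the homothety \<open>X \<mapsto> G - (X - G)/2\<close>, written in homogeneous coordinates.
\<close>

lift_definition compl_map :: "real^2 \<Rightarrow> real^2 \<Rightarrow> real^2 \<Rightarrow> epoint \<Rightarrow> epoint"
  is "\<lambda>A B C (v, t). (t *\<^sub>R centroid A B C - (1/2) *\<^sub>R (v - t *\<^sub>R centroid A B C), t)"
proof -
  fix A B C :: "real^2" and p q :: "(real^2) \<times> real"
  assume "hrel p q"
  then obtain c where c: "p \<noteq> 0" "c \<noteq> 0" "q = c *\<^sub>R p"
    by (auto simp: hrel_def)
  obtain v t where p: "p = (v, t)" by (cases p)
  with c show "hrel (case p of (v, t) \<Rightarrow>
                (t *\<^sub>R centroid A B C - (1/2) *\<^sub>R (v - t *\<^sub>R centroid A B C), t))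
            (case q of (v, t) \<Rightarrow>
                (t *\<^sub>R centroid A B C - (1/2) *\<^sub>R (v - t *\<^sub>R centroid A B C), t))"
    unfolding hrel_def
    by (auto simp: zero_prod_def algebra_simps intro!: exI[of _ c])
qed

lemma compl_map_fin_pt:
  "compl_map A B C (fin_pt X) = fin_pt (centroid A B C - (1/2) *\<^sub>R (X - centroid A B C))"
  by transfer (auto simp: hrel_def zero_prod_def intro!: exI[of _ 1])

lemma compl_map_at_inf: "at_inf P \<Longrightarrow> compl_map A B C P = P"
  by transfer (auto simp: hrel_def zero_prod_def intro!: exI[of _ "-2"])

text \<open>
  \<open>has_bary A B C x y z P\<close>: \<open>P\<close> has homogeneous barycentric coordinates \<open>(x, y, z)\<close> with respect
  to \<open>ABC\<close>, that is, \<open>P\<close> is represented by \<open>(x A + y B + z C, x + y + z)\<close>. This covers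
  points at infinity, for which \<open>x + y + z = 0\<close>.
\<close>

lift_definition has_bary ::
  "real^2 \<Rightarrow> real^2 \<Rightarrow> real^2 \<Rightarrow> real \<Rightarrow> real \<Rightarrow> real \<Rightarrow> epoint \<Rightarrow> bool"
  is "\<lambda>A B C x y z p. hrel p (x *\<^sub>R A + y *\<^sub>R B + z *\<^sub>R C, x + y + z)"
  using part_equivp_hrel by (metis part_equivp_symp part_equivp_transp)

text \<open>The isotomic map, for points not on the side lines (all coordinates nonzero).\<close>

definition isotomic :: "real^2 \<Rightarrow> real^2 \<Rightarrow> real^2 \<Rightarrow> epoint \<Rightarrow> epoint" where
  "isotomic A B C P = (THE P'. \<exists>x y z. x \<noteq> 0 \<and> y \<noteq> 0 \<and> z \<noteq> 0 \<and>
     has_bary A B C x y z P \<and> has_bary A B C (1/x) (1/y) (1/z) P')"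

text \<open>
  The points for which the generalized orthocenter is defined: those lying neither on the
  side lines of \<open>ABC\<close> nor on those of the anticomplementary triangle. As \<open>K\<close> is a bijection,
  the image of a line under its inverse is the preimage of that line under \<open>K\<close>.
\<close>

definition admissible :: "real^2 \<Rightarrow> real^2 \<Rightarrow> real^2 \<Rightarrow> epoint \<Rightarrow> bool" where
  "admissible A B C P \<longleftrightarrow>
     (\<forall>l \<in> {eline (fin_pt B) (fin_pt C), eline (fin_pt C) (fin_pt A), eline (fin_pt A) (fin_pt B)}.
        P \<notin> l \<and> P \<notin> compl_map A B C -` l)"

definition is_gen_orthocenter ::
  "real^2 \<Rightarrow> real^2 \<Rightarrow> real^2 \<Rightarrow> epoint \<Rightarrow> epoint \<Rightarrow> bool" where
  "is_gen_orthocenter A B C P H \<longleftrightarrow>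
     (let a = fin_pt A; b = fin_pt B; c = fin_pt C;
          Q = compl_map A B C (isotomic A B C P);
          D = meet (eline a P) (eline b c);
          E = meet (eline b P) (eline c a);
          F = meet (eline c P) (eline a b)
      in (H \<noteq> a \<longrightarrow> parallel (eline H a) (eline Q D)) \<and>
         (H \<noteq> b \<longrightarrow> parallel (eline H b) (eline Q E)) \<and>
         (H \<noteq> c \<longrightarrow> parallel (eline H c) (eline Q F)))"

definition gen_orthocenter :: "real^2 \<Rightarrow> real^2 \<Rightarrow> real^2 \<Rightarrow> epoint \<Rightarrow> epoint" where
  "gen_orthocenter A B C P = (THE H. is_gen_orthocenter A B C P H)"

definition locus_A :: "real^2 \<Rightarrow> real^2 \<Rightarrow> real^2 \<Rightarrow> epoint set" where
  "locus_A A B C = {P. admissible A B C P \<and> gen_orthocenter A B C P = fin_pt A}"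

text \<open>
  A (nondegenerate) conic is the zero set of the quadratic form of a nondegenerate symmetric
  bilinear form on homogeneous coordinates; its tangent at one of its points \<open>P\<close> is the set of
  points whose coordinates pair to zero with those of \<open>P\<close>.
\<close>

definition nondeg_sym_form :: "((real^2) \<times> real \<Rightarrow> (real^2) \<times> real \<Rightarrow> real) \<Rightarrow> bool" where
  "nondeg_sym_form \<beta> \<longleftrightarrow>
     bilinear \<beta> \<and> (\<forall>p q. \<beta> p q = \<beta> q p) \<and> (\<forall>p. (\<forall>q. \<beta> p q = 0) \<longrightarrow> p = 0)"

definition conic_of :: "((real^2) \<times> real \<Rightarrow> (real^2) \<times> real \<Rightarrow> real) \<Rightarrow> epoint set" where
  "conic_of \<beta> = {abs_epoint p | p. p \<noteq> 0 \<and> \<beta> p p = 0}"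

definition tangent_of ::
  "((real^2) \<times> real \<Rightarrow> (real^2) \<times> real \<Rightarrow> real) \<Rightarrow> epoint \<Rightarrow> epoint set" where
  "tangent_of \<beta> P = {abs_epoint q | q. q \<noteq> 0 \<and> (\<exists>p. p \<noteq> 0 \<and> abs_epoint p = P \<and> \<beta> p q = 0)}"

definition is_conic_A :: "real^2 \<Rightarrow> real^2 \<Rightarrow> real^2 \<Rightarrow> epoint set \<Rightarrow> bool" where
  "is_conic_A A B C S \<longleftrightarrow>
     (\<exists>\<beta>. nondeg_sym_form \<beta> \<and> S = conic_of \<beta> \<and>
        {fin_pt B, fin_pt C, fin_pt (midpoint C A), fin_pt (midpoint A B)} \<subseteq> S \<and>
        tangent_of \<beta> (fin_pt B) = compl_map A B C -` eline (fin_pt A) (fin_pt C) \<and>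
        tangent_of \<beta> (fin_pt C) = compl_map A B C -` eline (fin_pt A) (fin_pt B))"

end

theory Submission imports Defs begin

text \<open>
  Everything is computed in homogeneous barycentric coordinates with respect to \<open>ABC\<close>. Let
  \<open>P = (x, y, z)\<close> and \<open>s = xy + yz + zx\<close>. Then \<open>P' = (yz, zx, xy)\<close>, hence
  \<open>Q = (x(y + z), y(z + x), z(x + y))\<close>, while the traces of \<open>P\<close> are \<open>D = (0, y, z)\<close>,
  \<open>E = (x, 0, z)\<close>, \<open>F = (x, y, 0)\<close>. The point at infinity of \<open>QD\<close> turns out to have second and third
  coordinates \<open>y(z\<^sup>2 - s)\<close> and \<open>z(y\<^sup>2 - s)\<close>, so \<open>HA\<close> is parallel to \<open>QD\<close> exactly when those of
  \<open>H = (h\<^sub>1, h\<^sub>2, h\<^sub>3)\<close> are proportional to them (lemma \<open>vertex_condition_A\<close>); for \<open>H = A\<close> this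
  equation holds trivially, in agreement with the condition at \<open>A\<close> being void. With the two cyclic
  analogues one finds
  \<open>H = (x(y\<^sup>2 - s)(z\<^sup>2 - s), y(z\<^sup>2 - s)(x\<^sup>2 - s), z(x\<^sup>2 - s)(y\<^sup>2 - s))\<close>.
  For an admissible \<open>P\<close> at most one of \<open>x\<^sup>2 - s\<close>, \<open>y\<^sup>2 - s\<close>, \<open>z\<^sup>2 - s\<close> vanishes, so this is a
  point, and it is the only solution (lemma \<open>ex1_gen_orthocenter\<close>). This includes infinite \<open>P\<close> and
  the case \<open>s = 0\<close>, in which \<open>Q\<close> is infinite and \<open>H = Q\<close>. Reading off the coordinates,
  \<open>H = A\<close> if and only if \<open>x\<^sup>2 = s\<close>.

  The curve \<open>x\<^sup>2 = xy + yz + zx\<close> is the required conic: it passes through \<open>B\<close>, \<open>C\<close>, \<open>E\<^sub>0 = (1, 0, 1)\<close>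
  and \<open>F\<^sub>0 = (1, 1, 0)\<close>, and its tangents at \<open>B\<close> and \<open>C\<close> are \<open>z + x = 0\<close> and \<open>x + y = 0\<close>,
  the lines \<open>K\<^sup>-\<^sup>1(AC)\<close> and \<open>K\<^sup>-\<^sup>1(AB)\<close>. Conversely, comparing coefficients shows that a form
  meeting these requirements is a multiple of this one (lemma \<open>is_conic_A_unique\<close>). Finally, the
  six lines excluded by admissibility meet the curve only in \<open>B\<close>, \<open>C\<close>, \<open>E\<^sub>0\<close> and \<open>F\<^sub>0\<close>
  (lemma \<open>conic_A_inadmissible_iff\<close>).
\<close>

section \<open>Points of the extended plane and their homogeneous coordinates\<close>

lemma hrel_refl: "p \<noteq> 0 \<Longrightarrow> hrel p p"
  by (auto simp: hrel_def intro: exI[of _ 1])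

lemma fin_pt_eq_abs: "fin_pt X = abs_epoint (X, 1)"
  by (simp add: fin_pt_def)

lemma abs_epoint_eq_iff:
  assumes "p \<noteq> 0" "q \<noteq> 0"
  shows "abs_epoint p = abs_epoint q \<longleftrightarrow> (\<exists>c. c \<noteq> 0 \<and> q = c *\<^sub>R p)"
proof -
  have "abs_epoint p = abs_epoint q \<longleftrightarrow> hrel p q"
    using Quotient_rel[OF Quotient_epoint, of p q] hrel_refl[OF assms(1)] hrel_refl[OF assms(2)]
    by blast
  with assms show ?thesis by (simp add: hrel_def)
qed

lemma epoint_rep: obtains p where "p \<noteq> 0" "P = abs_epoint p"
proof
  show "rep_epoint P \<noteq> 0"
    using Quotient_rep_reflp[OF Quotient_epoint, of P] unfolding hrel_def by blast
  show "P = abs_epoint (rep_epoint P)"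
    by (rule Quotient_abs_rep[OF Quotient_epoint, symmetric])
qed

lemma at_inf_abs: "p \<noteq> 0 \<Longrightarrow> at_inf (abs_epoint p) \<longleftrightarrow> snd p = 0"
  by (rule at_inf.abs_eq) (simp add: eq_onp_def hrel_refl)

lemma in_eline_abs:
  assumes "p \<noteq> 0" "q \<noteq> 0" "r \<noteq> 0"
  shows "abs_epoint r \<in> eline (abs_epoint p) (abs_epoint q) \<longleftrightarrow> (\<exists>a b. r = a *\<^sub>R p + b *\<^sub>R q)"
proof -
  have "abs_epoint r \<in> eline (abs_epoint p) (abs_epoint q) \<longleftrightarrow> r \<in> span {p, q}"
    unfolding eline_def using assms by (simp add: on_line.abs_eq hrel_refl eq_onp_def)
  also have "\<dots> \<longleftrightarrow> (\<exists>a b. r = a *\<^sub>R p + b *\<^sub>R q)"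
    by (auto simp: span_breakdown_eq algebra_simps)
  finally show ?thesis .
qed

text \<open>
  A homogeneous condition on coordinate vectors may be tested on any representative. Both the points
  of a conic and its tangents are given as images of such conditions.
\<close>

lemma abs_epoint_in_iff_scale:
  assumes "p \<noteq> 0" and scale: "\<And>c q. q \<noteq> 0 \<Longrightarrow> c \<noteq> 0 \<Longrightarrow> R (c *\<^sub>R q) \<longleftrightarrow> R q"
  shows "(\<exists>q. abs_epoint p = abs_epoint q \<and> q \<noteq> 0 \<and> R q) \<longleftrightarrow> R p"
  using assms abs_epoint_eq_iff[OF assms(1)] by metis

section \<open>Barycentric coordinates\<close>

definition bary :: "real^2 \<Rightarrow> real^2 \<Rightarrow> real^2 \<Rightarrow> real \<Rightarrow> real \<Rightarrow> real \<Rightarrow> (real^2) \<times> real" where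
  "bary A B C x y z = (x *\<^sub>R A + y *\<^sub>R B + z *\<^sub>R C, x + y + z)"

definition bpt :: "real^2 \<Rightarrow> real^2 \<Rightarrow> real^2 \<Rightarrow> real \<Rightarrow> real \<Rightarrow> real \<Rightarrow> epoint" where
  "bpt A B C x y z = abs_epoint (bary A B C x y z)"

definition nonzero3 :: "real \<Rightarrow> real \<Rightarrow> real \<Rightarrow> bool" where
  "nonzero3 x y z \<longleftrightarrow> \<not> (x = 0 \<and> y = 0 \<and> z = 0)"

lemma nonzero3_one [simp]: "nonzero3 1 y z" "nonzero3 x 1 z" "nonzero3 x y 1"
  by (simp_all add: nonzero3_def)

lemma bary_add: "bary A B C (x + x') (y + y') (z + z') = bary A B C x y z + bary A B C x' y' z'"
  by (simp add: bary_def algebra_simps)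

lemma bary_scale: "bary A B C (c * x) (c * y) (c * z) = c *\<^sub>R bary A B C x y z"
  by (simp add: bary_def algebra_simps)

lemma bary_rotate: "bary B C A y z x = bary A B C x y z"
  by (simp add: bary_def algebra_simps)

lemma bpt_rotate: "bpt B C A y z x = bpt A B C x y z"
  by (simp add: bpt_def bary_rotate)

text \<open>
  The expression \<open>x\<^sup>2 - s\<close> from the introduction; its cyclic shifts give \<open>y\<^sup>2 - s\<close> and \<open>z\<^sup>2 - s\<close>.
\<close>

definition vertex_form :: "real \<Rightarrow> real \<Rightarrow> real \<Rightarrow> real" where
  "vertex_form x y z = x\<^sup>2 - (x * y + y * z + z * x)"

text \<open>
  The three conditions on \<open>H\<close> arise from one another by rotating the vertices. Working in a locale
  allows the result for one vertex to be reused by interpreting it in the rotated triangle.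
\<close>

locale triangle =
  fixes A B C :: "real^2"
  assumes noncollinear: "\<not> collinear {A, B, C}"
begin

abbreviation "br \<equiv> bary A B C"
abbreviation "pt \<equiv> bpt A B C"

lemma br_eq_0_iff: "br x y z = 0 \<longleftrightarrow> x = 0 \<and> y = 0 \<and> z = 0"
proof
  assume h: "br x y z = 0"
  then have x: "x = - y - z" and v: "x *\<^sub>R A + y *\<^sub>R B + z *\<^sub>R C = 0"
    by (auto simp: bary_def zero_prod_def)
  have rel: "y *\<^sub>R (B - A) + z *\<^sub>R (C - A) = 0"
    using v unfolding x by (simp add: algebra_simps)
  have nc: "\<not> collinear {0, B - A, C - A}"
    using noncollinear by (simp add: insert_commute[of A B] collinear_3)
  then have ne: "B - A \<noteq> 0" and nm: "\<And>k. C - A \<noteq> k *\<^sub>R (B - A)"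
    by (auto simp: collinear_lemma)
  have "z = 0"
  proof (rule ccontr)
    assume "z \<noteq> 0"
    have "z *\<^sub>R (C - A) = (- y) *\<^sub>R (B - A)"
      using rel by (simp add: algebra_simps)
    then have "inverse z *\<^sub>R z *\<^sub>R (C - A) = inverse z *\<^sub>R (- y) *\<^sub>R (B - A)"
      by simp
    with \<open>z \<noteq> 0\<close> have "C - A = (inverse z * (- y)) *\<^sub>R (B - A)"
      by simp
    with nm show False by blast
  qed
  with rel ne x show "x = 0 \<and> y = 0 \<and> z = 0" by simp
qed (simp add: bary_def zero_prod_def)

lemma br_eq_iff: "br x y z = br x' y' z' \<longleftrightarrow> x = x' \<and> y = y' \<and> z = z'"
proof -
  have "br x y z - br x' y' z' = br (x - x') (y - y') (z - z')"
    by (simp add: bary_def algebra_simps)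
  then show ?thesis
    using br_eq_0_iff[of "x - x'" "y - y'" "z - z'"] by (auto simp del: right_minus_eq)
qed

text \<open>
  A dimension count: precomposing with the coordinates of \<open>real^2 \<times> real\<close> makes the barycentric
  representation an injective linear endomorphism of that space.
\<close>

lemma br_surj: "\<exists>x y z. p = br x y z"
proof -
  let ?f = "\<lambda>v :: (real^2) \<times> real. br (fst v $ 1) (fst v $ 2) (snd v)"
  have lin: "linear ?f"
    by (intro linearI) (simp_all add: bary_add bary_scale)
  have "inj ?f"
    by (auto simp: inj_on_def br_eq_iff vec_eq_iff forall_2)
  with lin have "surj ?f"
    by (rule linear_inj_imp_surj)
  then obtain v where "p = ?f v" by (rule surjE)
  then show ?thesis by blast
qed

lemma pt_cases: obtains x y z where "nonzero3 x y z" "P = pt x y z"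
proof -
  obtain p where p: "p \<noteq> 0" "P = abs_epoint p" by (rule epoint_rep)
  obtain x y z where "p = br x y z" using br_surj by blast
  with p that show ?thesis by (metis br_eq_0_iff nonzero3_def bpt_def)
qed

lemma br_nonzero_iff [simp]: "br x y z \<noteq> 0 \<longleftrightarrow> nonzero3 x y z"
  by (auto simp: nonzero3_def br_eq_0_iff)

lemma pt_eq_iff_multiple:
  assumes "nonzero3 x y z" "nonzero3 x' y' z'"
  shows "pt x y z = pt x' y' z' \<longleftrightarrow> (\<exists>c. c \<noteq> 0 \<and> x' = c * x \<and> y' = c * y \<and> z' = c * z)"
  using assms
  by (simp add: bpt_def abs_epoint_eq_iff br_eq_iff flip: bary_scale)

text \<open>
  Vanishing cross product instead of an unknown factor: equality of points becomes a polynomial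
  identity.
\<close>

lemma pt_eq_iff:
  assumes "nonzero3 x y z" "nonzero3 x' y' z'"
  shows "pt x y z = pt x' y' z' \<longleftrightarrow> y * z' = z * y' \<and> z * x' = x * z' \<and> x * y' = y * x'"
proof
  assume "pt x y z = pt x' y' z'"
  then show "y * z' = z * y' \<and> z * x' = x * z' \<and> x * y' = y * x'"
    using assms by (auto simp: pt_eq_iff_multiple)
next
  assume h: "y * z' = z * y' \<and> z * x' = x * z' \<and> x * y' = y * x'"
  have "\<exists>c. x' = c * x \<and> y' = c * y \<and> z' = c * z"
  proof -
    consider "x \<noteq> 0" | "y \<noteq> 0" | "z \<noteq> 0" using assms(1) by (auto simp: nonzero3_def)
    then show ?thesis
    proof cases
      case 1 then show ?thesis using h by (intro exI[of _ "x' / x"]) (auto simp: field_simps)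
    next
      case 2 then show ?thesis using h by (intro exI[of _ "y' / y"]) (auto simp: field_simps)
    next
      case 3 then show ?thesis using h by (intro exI[of _ "z' / z"]) (auto simp: field_simps)
    qed
  qed
  then obtain c where "x' = c * x" "y' = c * y" "z' = c * z" by blast
  with assms show "pt x y z = pt x' y' z'"
    by (subst pt_eq_iff_multiple) (auto simp: nonzero3_def)
qed

lemma fin_pt_A: "fin_pt A = pt 1 0 0"
  and fin_pt_B: "fin_pt B = pt 0 1 0"
  and fin_pt_C: "fin_pt C = pt 0 0 1"
  by (simp_all add: fin_pt_eq_abs bpt_def bary_def)

lemma fin_pt_midpoints:
  "fin_pt (midpoint C A) = pt 1 0 1" "fin_pt (midpoint A B) = pt 1 1 0"
proof -
  have *: "(midpoint C A, 1) = br (1/2) 0 (1/2)" "(midpoint A B, 1) = br (1/2) (1/2) 0"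
    by (simp_all add: bary_def midpoint_def algebra_simps)
  show "fin_pt (midpoint C A) = pt 1 0 1" "fin_pt (midpoint A B) = pt 1 1 0"
    by (simp_all add: fin_pt_eq_abs * flip: bpt_def) (simp_all add: pt_eq_iff nonzero3_def)
qed

lemma at_inf_pt: "nonzero3 x y z \<Longrightarrow> at_inf (pt x y z) \<longleftrightarrow> x + y + z = 0"
  by (simp add: bpt_def at_inf_abs) (simp add: bary_def)

lemma in_eline_pt:
  assumes "nonzero3 u1 u2 u3" "nonzero3 v1 v2 v3" "nonzero3 w1 w2 w3"
  shows "pt w1 w2 w3 \<in> eline (pt u1 u2 u3) (pt v1 v2 v3) \<longleftrightarrow>
    (\<exists>a b. w1 = a * u1 + b * v1 \<and> w2 = a * u2 + b * v2 \<and> w3 = a * u3 + b * v3)"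
  using assms
  by (simp add: bpt_def in_eline_abs br_eq_iff flip: bary_scale bary_add)

section \<open>The maps and lines of the construction in coordinates\<close>

lemma in_side_lines:
  assumes "nonzero3 x y z"
  shows "pt x y z \<in> eline (fin_pt B) (fin_pt C) \<longleftrightarrow> x = 0"
    and "pt x y z \<in> eline (fin_pt C) (fin_pt A) \<longleftrightarrow> y = 0"
    and "pt x y z \<in> eline (fin_pt A) (fin_pt C) \<longleftrightarrow> y = 0"
    and "pt x y z \<in> eline (fin_pt A) (fin_pt B) \<longleftrightarrow> z = 0"
  using assms by (simp_all add: fin_pt_A fin_pt_B fin_pt_C in_eline_pt)

lemma compl_map_pt:
  assumes "nonzero3 x y z"
  shows "compl_map A B C (pt x y z) = pt (y + z) (z + x) (x + y)"
    and "nonzero3 (y + z) (z + x) (x + y)"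
proof -
  show nz: "nonzero3 (y + z) (z + x) (x + y)"
    using assms by (auto simp: nonzero3_def)
  have "compl_map A B C (pt x y z) = pt ((y + z) / 2) ((z + x) / 2) ((x + y) / 2)"
    unfolding bpt_def
    by (subst compl_map.abs_eq)
      (simp add: eq_onp_def hrel_refl assms,
       rule arg_cong[where f = abs_epoint],
       simp add: bary_def centroid_def vec_eq_iff field_simps)
  also have "\<dots> = pt (y + z) (z + x) (x + y)"
    using nz by (subst pt_eq_iff) (auto simp: nonzero3_def)
  finally show "compl_map A B C (pt x y z) = pt (y + z) (z + x) (x + y)" .
qed

lemma has_bary_pt:
  assumes "nonzero3 u v w"
  shows "has_bary A B C x y z (pt u v w) \<longleftrightarrow> nonzero3 x y z \<and> pt u v w = pt x y z"
proof -
  have "has_bary A B C x y z (pt u v w) \<longleftrightarrow> hrel (br u v w) (br x y z)"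
    unfolding bpt_def
    by (subst has_bary.abs_eq) (simp_all add: eq_onp_def hrel_refl assms, simp add: bary_def)
  also have "\<dots> \<longleftrightarrow> nonzero3 x y z \<and> pt u v w = pt x y z"
    using assms abs_epoint_eq_iff[of "br u v w" "br x y z"]
    by (auto simp: hrel_def bpt_def simp del: br_nonzero_iff)
      (simp_all flip: br_nonzero_iff)
  finally show ?thesis .
qed

text \<open>
  The reciprocals \<open>(1/x, 1/y, 1/z)\<close> are multiplied by \<open>xyz\<close> to stay polynomial.
\<close>

lemma isotomic_pt:
  assumes "x \<noteq> 0" "y \<noteq> 0" "z \<noteq> 0"
  shows "isotomic A B C (pt x y z) = pt (y * z) (z * x) (x * y)"
  unfolding isotomic_def
proof (rule the_equality)
  have nz: "nonzero3 x y z" using assms by (simp add: nonzero3_def)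
  show "\<exists>x' y' z'. x' \<noteq> 0 \<and> y' \<noteq> 0 \<and> z' \<noteq> 0 \<and> has_bary A B C x' y' z' (pt x y z) \<and>
      has_bary A B C (1/x') (1/y') (1/z') (pt (y * z) (z * x) (x * y))"
    by (rule exI[of _ x], rule exI[of _ y], rule exI[of _ z])
      (use assms in \<open>simp add: has_bary_pt nonzero3_def pt_eq_iff\<close>)
next
  fix P' assume "\<exists>x' y' z'. x' \<noteq> 0 \<and> y' \<noteq> 0 \<and> z' \<noteq> 0 \<and> has_bary A B C x' y' z' (pt x y z) \<and>
      has_bary A B C (1/x') (1/y') (1/z') P'"
  then obtain x' y' z' where h: "x' \<noteq> 0" "y' \<noteq> 0" "z' \<noteq> 0" "has_bary A B C x' y' z' (pt x y z)"
      "has_bary A B C (1/x') (1/y') (1/z') P'" by blast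
  obtain u v w where P': "nonzero3 u v w" "P' = pt u v w" by (rule pt_cases)
  have "pt x y z = pt x' y' z'" using h assms by (simp add: has_bary_pt nonzero3_def)
  then obtain c where c: "c \<noteq> 0" "x' = c * x" "y' = c * y" "z' = c * z"
    using h assms by (auto simp: pt_eq_iff_multiple nonzero3_def)
  have "P' = pt (1/x') (1/y') (1/z')" using h P' by (simp add: has_bary_pt)
  also have "\<dots> = pt (y * z) (z * x) (x * y)"
    using assms c by (subst pt_eq_iff) (auto simp: nonzero3_def)
  finally show "P' = pt (y * z) (z * x) (x * y)" .
qed

lemma admissible_pt:
  assumes "nonzero3 x y z"
  shows "admissible A B C (pt x y z) \<longleftrightarrow>
    x \<noteq> 0 \<and> y \<noteq> 0 \<and> z \<noteq> 0 \<and> y + z \<noteq> 0 \<and> z + x \<noteq> 0 \<and> x + y \<noteq> 0"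
  using assms by (auto simp: admissible_def in_side_lines compl_map_pt)

lemma trace_on_BC:
  assumes "y \<noteq> 0"
  shows "meet (eline (fin_pt A) (pt x y z)) (eline (fin_pt B) (fin_pt C)) = pt 0 y z"
  unfolding meet_def
proof (rule the_equality)
  have nz: "nonzero3 1 0 0" "nonzero3 x y z" "nonzero3 0 y z" using assms by (simp_all add: nonzero3_def)
  show "pt 0 y z \<in> eline (fin_pt A) (pt x y z) \<and> pt 0 y z \<in> eline (fin_pt B) (fin_pt C)"
  proof
    have "\<exists>a b. 0 = a * 1 + b * x \<and> y = a * 0 + b * y \<and> z = a * 0 + b * z"
      by (rule exI[of _ "-x"], rule exI[of _ 1]) simp
    then show "pt 0 y z \<in> eline (fin_pt A) (pt x y z)"
      unfolding fin_pt_A using nz by (subst in_eline_pt) auto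
    show "pt 0 y z \<in> eline (fin_pt B) (fin_pt C)"
      using nz by (simp add: in_side_lines)
  qed
  fix X assume X: "X \<in> eline (fin_pt A) (pt x y z) \<and> X \<in> eline (fin_pt B) (fin_pt C)"
  obtain u v w where u: "nonzero3 u v w" "X = pt u v w" by (rule pt_cases)
  with X nz obtain a b where "u = 0" "v = b * y" "w = b * z"
    by (auto simp: in_side_lines) (auto simp: fin_pt_A in_eline_pt)
  with u nz show "X = pt 0 y z" by (simp add: pt_eq_iff)
qed

text \<open>
  A point at infinity is determined by its last two coordinates. On the line \<open>HA\<close> these are, up to
  a factor, \<open>h2\<close> and \<open>h3\<close>. On the line joining \<open>Q = (q1, q2, q3)\<close> to \<open>D = (0, y, z)\<close>, eliminating
  the coordinate sum gives the combination \<open>(y + z) Q - (q1 + q2 + q3) D\<close>; its first coordinate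
  \<open>q1 (y + z)\<close> is nonzero, so it is a genuine point even when \<open>Q\<close> is itself at infinity.
\<close>

lemma parallel_iff:
  assumes h: "nonzero3 h1 h2 h3" "\<not> (h2 = 0 \<and> h3 = 0)" and q: "q1 \<noteq> 0" and yz: "y + z \<noteq> 0"
  shows "parallel (eline (pt h1 h2 h3) (pt 1 0 0)) (eline (pt q1 q2 q3) (pt 0 y z)) \<longleftrightarrow>
    h2 * (q3 * (y + z) - z * (q1 + q2 + q3)) = h3 * (q2 * (y + z) - y * (q1 + q2 + q3))"
    (is "?L \<longleftrightarrow> h2 * ?n3 = h3 * ?n2")
proof
  let ?s = "q1 + q2 + q3"
  have nz: "nonzero3 1 0 0" "nonzero3 q1 q2 q3" "nonzero3 0 y z"
    using q yz by (auto simp: nonzero3_def)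
  {
    assume ?L
    then obtain X where X: "at_inf X" "X \<in> eline (pt h1 h2 h3) (pt 1 0 0)"
        "X \<in> eline (pt q1 q2 q3) (pt 0 y z)"
      by (auto simp: parallel_def)
    obtain u v w where u: "nonzero3 u v w" "X = pt u v w" by (rule pt_cases)
    from X u h nz obtain a b where ab: "u = a * h1 + b" "v = a * h2" "w = a * h3"
      by (auto simp: in_eline_pt)
    from X u nz obtain c d where cd: "u = c * q1" "v = c * q2 + d * y" "w = c * q3 + d * z"
      by (auto simp: in_eline_pt)
    have sum: "u + v + w = 0" using X u by (simp add: at_inf_pt)
    have "a \<noteq> 0" using u sum ab by (auto simp: nonzero3_def)
    have dd: "d * (y + z) = - (c * ?s)" using sum unfolding cd by algebra
    have "v * (y + z) = c * ?n2" "w * (y + z) = c * ?n3"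
      using dd unfolding cd by algebra+
    then have "(y + z) * (a * (h2 * ?n3)) = (y + z) * (a * (h3 * ?n2))"
      unfolding ab by algebra
    with \<open>a \<noteq> 0\<close> yz show "h2 * ?n3 = h3 * ?n2" by simp
  }
  assume eq: "h2 * ?n3 = h3 * ?n2"
  define u where "u = q1 * (y + z)"
  have nzX: "nonzero3 u ?n2 ?n3" using q yz by (simp add: nonzero3_def u_def)
  have "u + ?n2 + ?n3 = 0" by (simp add: u_def algebra_simps)
  then have "at_inf (pt u ?n2 ?n3)" using nzX by (simp add: at_inf_pt)
  moreover have "pt u ?n2 ?n3 \<in> eline (pt q1 q2 q3) (pt 0 y z)"
  proof -
    have "\<exists>a b. u = a * q1 + b * 0 \<and> ?n2 = a * q2 + b * y \<and> ?n3 = a * q3 + b * z"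
      by (rule exI[of _ "y + z"], rule exI[of _ "- ?s"]) (simp add: u_def algebra_simps)
    with nz nzX show ?thesis by (simp add: in_eline_pt)
  qed
  moreover have "pt u ?n2 ?n3 \<in> eline (pt h1 h2 h3) (pt 1 0 0)"
  proof -
    obtain a where a: "?n2 = a * h2" "?n3 = a * h3"
    proof (cases "h2 = 0")
      case True with h eq that[of "?n3 / h3"] show ?thesis by auto
    next
      case False with eq that[of "?n2 / h2"] show ?thesis by (auto simp: field_simps)
    qed
    have "\<exists>c d. u = c * h1 + d * 1 \<and> ?n2 = c * h2 + d * 0 \<and> ?n3 = c * h3 + d * 0"
      by (rule exI[of _ a], rule exI[of _ "u - a * h1"]) (simp add: a)
    with nz h nzX show ?thesis by (simp add: in_eline_pt)
  qed
  ultimately show ?L unfolding parallel_def by blast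
qed

section \<open>The generalized orthocenter\<close>

lemma triangle_rotate: "triangle B C A"
  using noncollinear by unfold_locales (simp add: insert_commute)

text \<open>
  The equation covers both alternatives of the implication: \<open>H = A\<close> means \<open>h2 = h3 = 0\<close>, which makes
  it true.
\<close>

lemma vertex_condition_A:
  assumes xyz: "x \<noteq> 0" "y \<noteq> 0" "z \<noteq> 0" "y + z \<noteq> 0" and h: "nonzero3 h1 h2 h3"
  shows "(pt h1 h2 h3 \<noteq> fin_pt A \<longrightarrow>
      parallel (eline (pt h1 h2 h3) (fin_pt A))
        (eline (pt (x * (y + z)) (y * (z + x)) (z * (x + y)))
          (meet (eline (fin_pt A) (pt x y z)) (eline (fin_pt B) (fin_pt C)))))
    \<longleftrightarrow> h2 * z * vertex_form y z x = h3 * y * vertex_form z x y"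
proof -
  have A: "pt h1 h2 h3 = fin_pt A \<longleftrightarrow> h2 = 0 \<and> h3 = 0"
    using h by (auto simp: fin_pt_A pt_eq_iff)
  show ?thesis
  proof (cases "h2 = 0 \<and> h3 = 0")
    case True
    with A show ?thesis by simp
  next
    case False
    let ?q1 = "x * (y + z)" and ?q2 = "y * (z + x)" and ?q3 = "z * (x + y)"
    have "?q3 * (y + z) - z * (?q1 + ?q2 + ?q3) = z * vertex_form y z x"
      and "?q2 * (y + z) - y * (?q1 + ?q2 + ?q3) = y * vertex_form z x y"
      by (simp_all add: vertex_form_def power2_eq_square algebra_simps)
    then show ?thesis
      using A False parallel_iff[OF h False, of ?q1 y z ?q2 ?q3] xyz
      unfolding trace_on_BC[OF xyz(2)] by (simp add: fin_pt_A mult.assoc)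
  qed
qed

lemma is_gen_orthocenter_pt:
  assumes adm: "admissible A B C (pt x y z)" and p: "nonzero3 x y z" and h: "nonzero3 h1 h2 h3"
  shows "is_gen_orthocenter A B C (pt x y z) (pt h1 h2 h3) \<longleftrightarrow>
    h2 * z * vertex_form y z x = h3 * y * vertex_form z x y \<and>
    h3 * x * vertex_form z x y = h1 * z * vertex_form x y z \<and>
    h1 * y * vertex_form x y z = h2 * x * vertex_form y z x"
proof -
  interpret BCA: triangle B C A by (rule triangle_rotate)
  interpret CAB: triangle C A B by (rule BCA.triangle_rotate)
  have nz: "x \<noteq> 0" "y \<noteq> 0" "z \<noteq> 0" "y + z \<noteq> 0" "z + x \<noteq> 0" "x + y \<noteq> 0"
    using adm p by (simp_all add: admissible_pt)
  have rot: "bpt C A B = (\<lambda>z x y. pt x y z)" "bpt B C A = (\<lambda>y z x. pt x y z)"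
    by (intro ext, metis bpt_rotate)+
  have P': "nonzero3 (y * z) (z * x) (x * y)" using nz by (simp add: nonzero3_def)
  have Q: "compl_map A B C (isotomic A B C (pt x y z)) = pt (x * (y + z)) (y * (z + x)) (z * (x + y))"
    using nz P' by (simp add: isotomic_pt compl_map_pt algebra_simps)
  have h': "nonzero3 h2 h3 h1" "nonzero3 h3 h1 h2" using h by (auto simp: nonzero3_def)
  show ?thesis
    unfolding is_gen_orthocenter_def Let_def Q
    using vertex_condition_A[OF nz(1-4) h]
      BCA.vertex_condition_A[OF nz(2,3,1,5) h'(1)]
      CAB.vertex_condition_A[OF nz(3,1,2,6) h'(2)]
    unfolding rot by (simp only:)
qed

text \<open>
  Subtracting the two equations gives \<open>x\<^sup>2 = y\<^sup>2\<close>, so \<open>x = y\<close> as \<open>x + y \<noteq> 0\<close>; the first then reads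
  \<open>2xz = 0\<close>.
\<close>

lemma vertex_forms_not_both_zero:
  assumes "x \<noteq> 0" "y \<noteq> 0" "z \<noteq> 0" "x + y \<noteq> 0"
  shows "\<not> (vertex_form x y z = 0 \<and> vertex_form y z x = 0)"
proof
  assume h: "vertex_form x y z = 0 \<and> vertex_form y z x = 0"
  then have "(x - y) * (x + y) = 0"
    by (simp add: vertex_form_def power2_eq_square algebra_simps)
  with assms have "x = y" by simp
  with h assms show False by (simp add: vertex_form_def power2_eq_square)
qed

text \<open>
  The three conditions say that \<open>h\<^sub>1 (x\<^sup>2 - s) / x\<close>, \<open>h\<^sub>2 (y\<^sup>2 - s) / y\<close>, \<open>h\<^sub>3 (z\<^sup>2 - s) / z\<close> are equal.
  Clearing denominators in the obvious solution gives the coordinates used here; multiplying each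
  condition by the missing factor shows that any other solution is proportional to them.
\<close>

lemma ex1_gen_orthocenter:
  assumes "admissible A B C P"
  shows "\<exists>!H. is_gen_orthocenter A B C P H"
proof -
  obtain x y z where P: "nonzero3 x y z" "P = pt x y z" by (rule pt_cases)
  let ?a = "vertex_form x y z" and ?b = "vertex_form y z x" and ?c = "vertex_form z x y"
  have nz: "x \<noteq> 0" "y \<noteq> 0" "z \<noteq> 0" "y + z \<noteq> 0" "z + x \<noteq> 0" "x + y \<noteq> 0"
    using assms P by (simp_all add: admissible_pt)
  have nzH: "nonzero3 (x * ?b * ?c) (y * ?c * ?a) (z * ?a * ?b)"
    using nz vertex_forms_not_both_zero[of x y z] vertex_forms_not_both_zero[of y z x] vertex_forms_not_both_zero[of z x y]
    by (auto simp: nonzero3_def)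
  show ?thesis
  proof (rule ex1I)
    show "is_gen_orthocenter A B C P (pt (x * ?b * ?c) (y * ?c * ?a) (z * ?a * ?b))"
      using assms P nzH by (simp add: is_gen_orthocenter_pt)
  next
    fix H assume H: "is_gen_orthocenter A B C P H"
    obtain h1 h2 h3 where h: "nonzero3 h1 h2 h3" "H = pt h1 h2 h3" by (rule pt_cases)
    have eqs: "h2 * z * ?b = h3 * y * ?c" "h3 * x * ?c = h1 * z * ?a" "h1 * y * ?a = h2 * x * ?b"
      using H assms P h by (simp_all add: is_gen_orthocenter_pt)
    have "h2 * (z * ?a * ?b) = h3 * (y * ?c * ?a)" "h3 * (x * ?b * ?c) = h1 * (z * ?a * ?b)"
         "h1 * (y * ?c * ?a) = h2 * (x * ?b * ?c)"
      using eqs by algebra+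
    then show "H = pt (x * ?b * ?c) (y * ?c * ?a) (z * ?a * ?b)"
      using h nzH by (simp add: pt_eq_iff)
  qed
qed

text \<open>
  Since \<open>H\<close> exists uniquely, \<open>H = A\<close> may be decided by substituting \<open>(1, 0, 0)\<close> into the conditions.
  The one at \<open>A\<close> is void, the other two are \<open>z (x\<^sup>2 - s) = 0\<close> and \<open>y (x\<^sup>2 - s) = 0\<close>.
\<close>

lemma pt_in_locus_A_iff:
  assumes p: "nonzero3 x y z"
  shows "pt x y z \<in> locus_A A B C \<longleftrightarrow> admissible A B C (pt x y z) \<and> vertex_form x y z = 0"
proof (cases "admissible A B C (pt x y z)")
  case True
  with p have nz: "y \<noteq> 0" by (simp add: admissible_pt)
  have "gen_orthocenter A B C (pt x y z) = fin_pt A \<longleftrightarrow>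
      is_gen_orthocenter A B C (pt x y z) (fin_pt A)"
    unfolding gen_orthocenter_def using ex1_gen_orthocenter[OF True] by (metis theI')
  also have "\<dots> \<longleftrightarrow> vertex_form x y z = 0"
    using True p nz by (auto simp: fin_pt_A is_gen_orthocenter_pt)
  finally show ?thesis
    using True by (simp add: locus_A_def)
qed (simp add: locus_A_def)

section \<open>The locus as a punctured conic\<close>

definition conic_A :: "epoint set" where
  "conic_A = {pt x y z | x y z. nonzero3 x y z \<and> vertex_form x y z = 0}"

lemma pt_in_conic_A_iff:
  assumes "nonzero3 x y z"
  shows "pt x y z \<in> conic_A \<longleftrightarrow> vertex_form x y z = 0"
proof
  assume "pt x y z \<in> conic_A"
  then obtain x' y' z' where "nonzero3 x' y' z'" "vertex_form x' y' z' = 0" "pt x' y' z' = pt x y z"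
    by (auto simp: conic_A_def)
  moreover from this obtain c where "x = c * x'" "y = c * y'" "z = c * z'"
    using assms by (auto simp: pt_eq_iff_multiple)
  moreover from this have "vertex_form x y z = c\<^sup>2 * vertex_form x' y' z'"
    by (simp add: vertex_form_def power2_eq_square algebra_simps)
  ultimately show "vertex_form x y z = 0" by simp
qed (use assms in \<open>auto simp: conic_A_def\<close>)

text \<open>
  On the conic, \<open>x = 0\<close> forces \<open>yz = 0\<close>, while \<open>y = 0\<close> forces \<open>x = 0\<close> or \<open>x = z\<close>, and similarly
  for \<open>z = 0\<close>. Two of the remaining lines, \<open>z + x = 0\<close> and \<open>x + y = 0\<close>, are the tangents at \<open>B\<close> and
  \<open>C\<close>, and on \<open>y + z = 0\<close> the equation becomes \<open>x\<^sup>2 + y\<^sup>2 = 0\<close>, which has no real point.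
\<close>

lemma conic_A_inadmissible_iff:
  assumes p: "nonzero3 x y z" and on: "vertex_form x y z = 0"
  shows "\<not> admissible A B C (pt x y z) \<longleftrightarrow>
    pt x y z \<in> {fin_pt B, fin_pt C, fin_pt (midpoint C A), fin_pt (midpoint A B)}"
proof -
  have e1: "x * x = y * z + x * (y + z)" using on by (simp add: vertex_form_def power2_eq_square algebra_simps)
  have "pt x y z \<in> {fin_pt B, fin_pt C, fin_pt (midpoint C A), fin_pt (midpoint A B)} \<longleftrightarrow>
      x = 0 \<and> z = 0 \<or> x = 0 \<and> y = 0 \<or> x = z \<and> y = 0 \<or> x = y \<and> z = 0"
    using p by (auto simp: fin_pt_B fin_pt_C fin_pt_midpoints pt_eq_iff nonzero3_def)
  also have "\<dots> \<longleftrightarrow> x = 0 \<or> y = 0 \<or> z = 0 \<or> y + z = 0 \<or> z + x = 0 \<or> x + y = 0"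
  proof
    assume r: "x = 0 \<or> y = 0 \<or> z = 0 \<or> y + z = 0 \<or> z + x = 0 \<or> x + y = 0"
    have 1: "x = 0 \<and> y = 0 \<and> z = 0" if "y + z = 0"
    proof -
      have "z = - y" using that by simp
      then have "x\<^sup>2 + y\<^sup>2 = 0" using e1 by (simp add: power2_eq_square)
      then show ?thesis using \<open>z = - y\<close> by (simp add: sum_power2_eq_zero_iff)
    qed
    have 2: "x = 0 \<and> z = 0" if "z + x = 0"
    proof -
      have "z = - x" using that by simp
      then show ?thesis using e1 by (simp add: algebra_simps)
    qed
    have 3: "x = 0 \<and> y = 0" if "x + y = 0"
    proof -
      have "y = - x" using that by simp
      then show ?thesis using e1 by (simp add: algebra_simps)
    qed
    show "x = 0 \<and> z = 0 \<or> x = 0 \<and> y = 0 \<or> x = z \<and> y = 0 \<or> x = y \<and> z = 0"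
      using r 1 2 3 e1 by (auto simp: algebra_simps)
  qed auto
  finally show ?thesis using p by (auto simp: admissible_pt)
qed

lemma locus_A_eq:
  "locus_A A B C = conic_A - {fin_pt B, fin_pt C, fin_pt (midpoint C A), fin_pt (midpoint A B)}"
proof (rule set_eqI)
  fix P
  obtain x y z where P: "nonzero3 x y z" "P = pt x y z" by (rule pt_cases)
  show "P \<in> locus_A A B C \<longleftrightarrow>
    P \<in> conic_A - {fin_pt B, fin_pt C, fin_pt (midpoint C A), fin_pt (midpoint A B)}"
    unfolding Diff_iff P(2) pt_in_locus_A_iff[OF P(1)] pt_in_conic_A_iff[OF P(1)]
    using conic_A_inadmissible_iff[OF P(1)] by blast
qed

section \<open>Existence and uniqueness of the conic\<close>

lemma bilinear_br:
  assumes "bilinear \<beta>"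
  shows "\<beta> (br x y z) (br u v w) =
    x * u * \<beta> (br 1 0 0) (br 1 0 0) + x * v * \<beta> (br 1 0 0) (br 0 1 0) + x * w * \<beta> (br 1 0 0) (br 0 0 1) +
    y * u * \<beta> (br 0 1 0) (br 1 0 0) + y * v * \<beta> (br 0 1 0) (br 0 1 0) + y * w * \<beta> (br 0 1 0) (br 0 0 1) +
    z * u * \<beta> (br 0 0 1) (br 1 0 0) + z * v * \<beta> (br 0 0 1) (br 0 1 0) + z * w * (\<beta> (br 0 0 1) (br 0 0 1) :: real)"
proof -
  have br: "br x y z = x *\<^sub>R br 1 0 0 + y *\<^sub>R br 0 1 0 + z *\<^sub>R br 0 0 1" for x y z
    by (simp add: bary_def)
  show ?thesis
    unfolding br[of x y z] br[of u v w]
    using assms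
    by (simp add: bilinear_ladd bilinear_radd bilinear_lmul bilinear_rmul algebra_simps)
qed

lemma pt_in_conic_of_iff:
  assumes "bilinear \<beta>" "nonzero3 x y z"
  shows "pt x y z \<in> conic_of \<beta> \<longleftrightarrow> \<beta> (br x y z) (br x y z) = 0"
  using abs_epoint_in_iff_scale[of "br x y z" "\<lambda>q. \<beta> q q = 0"] assms
  by (simp add: conic_of_def bpt_def bilinear_lmul bilinear_rmul)

lemma pt_in_tangent_of_iff:
  assumes "bilinear \<beta>" "nonzero3 x y z" "nonzero3 u v w"
  shows "pt u v w \<in> tangent_of \<beta> (pt x y z) \<longleftrightarrow> \<beta> (br x y z) (br u v w) = 0"
proof -
  have "(\<exists>p. p \<noteq> 0 \<and> abs_epoint p = pt x y z \<and> \<beta> p q = 0) \<longleftrightarrow>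
      (\<exists>p. pt x y z = abs_epoint p \<and> p \<noteq> 0 \<and> \<beta> p q = 0)" for q
    by metis
  also have "(\<exists>p. pt x y z = abs_epoint p \<and> p \<noteq> 0 \<and> \<beta> p q = 0) \<longleftrightarrow> \<beta> (br x y z) q = 0" for q
    using abs_epoint_in_iff_scale[of "br x y z" "\<lambda>p. \<beta> p q = 0"] assms
    by (simp add: bpt_def bilinear_lmul)
  finally have "(\<exists>p. p \<noteq> 0 \<and> abs_epoint p = pt x y z \<and> \<beta> p q = 0) \<longleftrightarrow> \<beta> (br x y z) q = 0" for q .
  then show ?thesis
    using abs_epoint_in_iff_scale[of "br u v w" "\<lambda>q. \<beta> (br x y z) q = 0"] assms
    by (simp add: tangent_of_def bpt_def[of _ _ _ u] bilinear_rmul)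
qed

lemma tangent_lines:
  assumes "nonzero3 u v w"
  shows "pt u v w \<in> compl_map A B C -` eline (fin_pt A) (fin_pt C) \<longleftrightarrow> w + u = 0"
    and "pt u v w \<in> compl_map A B C -` eline (fin_pt A) (fin_pt B) \<longleftrightarrow> u + v = 0"
  using assms by (simp_all add: compl_map_pt in_side_lines)

text \<open>
  In the basis given by the vertices, incidence with \<open>B\<close> and \<open>C\<close> kills two diagonal coefficients
  of the form. Evaluating the tangents at the points at infinity of \<open>CA\<close> and \<open>AB\<close> makes all
  mixed coefficients equal to one number \<open>k\<close>, and incidence with the midpoint of \<open>CA\<close> expresses the
  last coefficient by \<open>k\<close>. The form is thus determined up to the factor \<open>k\<close>, which is nonzero by
  nondegeneracy.
\<close>

lemma is_conic_A_unique:
  assumes "is_conic_A A B C S"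
  shows "S = conic_A"
proof -
  obtain \<beta> where nd: "nondeg_sym_form \<beta>" and S: "S = conic_of \<beta>"
    and pts: "fin_pt B \<in> S" "fin_pt C \<in> S" "fin_pt (midpoint C A) \<in> S"
    and tB: "tangent_of \<beta> (fin_pt B) = compl_map A B C -` eline (fin_pt A) (fin_pt C)"
    and tC: "tangent_of \<beta> (fin_pt C) = compl_map A B C -` eline (fin_pt A) (fin_pt B)"
    using assms unfolding is_conic_A_def by auto
  have bil: "bilinear \<beta>" and sym: "\<And>p q. \<beta> p q = \<beta> q p"
    and nondeg: "\<And>p. (\<forall>q. \<beta> p q = 0) \<Longrightarrow> p = 0"
    using nd unfolding nondeg_sym_form_def by blast+
  let ?a = "br 1 0 0" and ?b = "br 0 1 0" and ?c = "br 0 0 1"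
  define k where "k = \<beta> ?b ?c"
  have bb: "\<beta> ?b ?b = 0" and cc: "\<beta> ?c ?c = 0"
    using pts bil unfolding S by (simp_all add: fin_pt_B fin_pt_C pt_in_conic_of_iff)
  have ac: "\<beta> ?a ?a + 2 * \<beta> ?a ?c = 0"
    using pts(3) bil cc unfolding S
    by (simp add: fin_pt_midpoints pt_in_conic_of_iff bilinear_br[OF bil, of 1 0 1 1 0 1] sym[of ?c ?a])
  have "pt 1 0 (-1) \<in> tangent_of \<beta> (fin_pt B)" "pt 1 (-1) 0 \<in> tangent_of \<beta> (fin_pt C)"
    unfolding tB tC using tangent_lines[of 1 0 "-1"] tangent_lines[of 1 "-1" 0]
    by (simp_all del: vimage_eq)
  then have "\<beta> ?b (br 1 0 (-1)) = 0" "\<beta> ?c (br 1 (-1) 0) = 0"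
    using bil by (simp_all add: fin_pt_B fin_pt_C pt_in_tangent_of_iff)
  then have ab: "\<beta> ?a ?b = k" and "\<beta> ?a ?c = k"
    using bilinear_br[OF bil, of 0 1 0 1 0 "-1"] bilinear_br[OF bil, of 0 0 1 1 "-1" 0]
    by (simp_all add: k_def sym[of ?b ?a] sym[of ?c ?a] sym[of ?c ?b])
  note coeffs = bb cc ab this(2)
  have aa: "\<beta> ?a ?a = - 2 * k" using ac coeffs by simp
  have form: "\<beta> (br x y z) (br x y z) = - 2 * k * vertex_form x y z" for x y z
    unfolding bilinear_br[OF bil, of x y z]
    using coeffs aa sym[of ?b ?a] sym[of ?c ?a] sym[of ?c ?b]
    by (simp add: vertex_form_def power2_eq_square algebra_simps flip: k_def)
  have "k \<noteq> 0"
  proof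
    assume "k = 0"
    have "\<beta> ?b q = 0" for q
    proof -
      obtain u v w where "q = br u v w" using br_surj by blast
      then show ?thesis
        using bilinear_br[OF bil, of 0 1 0 u v w] coeffs \<open>k = 0\<close> sym[of ?b ?a]
        by (simp flip: k_def)
    qed
    then have "?b = 0" by (rule nondeg[rule_format])
    then show False by (simp add: br_eq_0_iff)
  qed
  show ?thesis
  proof (rule set_eqI)
    fix P
    obtain x y z where P: "nonzero3 x y z" "P = pt x y z" by (rule pt_cases)
    show "P \<in> S \<longleftrightarrow> P \<in> conic_A"
      using P \<open>k \<noteq> 0\<close> bil unfolding S by (simp add: pt_in_conic_of_iff pt_in_conic_A_iff form)
  qed
qed

text \<open>
  The witness is twice the polarization of \<open>x\<^sup>2 - s\<close>. To define it on \<open>real^2 \<times> real\<close>, the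
  barycentric coordinates are first turned into linear functionals.
\<close>

lemma is_conic_A_conic_A: "is_conic_A A B C conic_A"
proof -
  obtain X Y Z where co: "\<And>p. p = br (X p) (Y p) (Z p)"
    using br_surj by metis
  have co_br: "X (br x y z) = x" "Y (br x y z) = y" "Z (br x y z) = z" for x y z
    using co[of "br x y z"] unfolding br_eq_iff by simp_all
  have co_add: "X (p + q) = X p + X q \<and> Y (p + q) = Y p + Y q \<and> Z (p + q) = Z p + Z q" for p q
    using co[of "p + q"] co[of p] co[of q] by (metis bary_add br_eq_iff)
  have co_scale: "X (c *\<^sub>R p) = c * X p \<and> Y (c *\<^sub>R p) = c * Y p \<and> Z (c *\<^sub>R p) = c * Z p" for c p
    using co[of "c *\<^sub>R p"] co[of p] by (metis bary_scale br_eq_iff)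
  define \<beta> where "\<beta> = (\<lambda>p q. 2 * X p * X q - X p * (Y q + Z q) - Y p * (Z q + X q) - Z p * (X q + Y q))"
  have bil: "bilinear \<beta>"
    unfolding bilinear_def \<beta>_def
    by (intro conjI allI linearI) (simp_all add: co_add co_scale algebra_simps)
  have \<beta>_br: "\<beta> (br x y z) (br u v w) = 2 * x * u - x * (v + w) - y * (w + u) - z * (u + v)" for x y z u v w
    by (simp add: \<beta>_def co_br)
  have "p = 0" if "\<forall>q. \<beta> p q = 0" for p
  proof -
    obtain x y z where p: "p = br x y z" using br_surj by blast
    have "\<beta> p (br 1 0 0) = 0" "\<beta> p (br 0 1 0) = 0" "\<beta> p (br 0 0 1) = 0" using that by blast+
    then have "x = 0 \<and> y = 0 \<and> z = 0" unfolding p \<beta>_br by simp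
    then show ?thesis unfolding p br_eq_0_iff .
  qed
  then have nd: "nondeg_sym_form \<beta>"
    using bil unfolding nondeg_sym_form_def by (auto simp: \<beta>_def algebra_simps)
  have conic: "conic_A = conic_of \<beta>"
  proof (rule set_eqI)
    fix P
    obtain x y z where P: "nonzero3 x y z" "P = pt x y z" by (rule pt_cases)
    have "\<beta> (br x y z) (br x y z) = 2 * vertex_form x y z"
      by (simp add: \<beta>_br vertex_form_def power2_eq_square algebra_simps)
    then show "P \<in> conic_A \<longleftrightarrow> P \<in> conic_of \<beta>"
      using P bil by (simp add: pt_in_conic_of_iff pt_in_conic_A_iff)
  qed
  have tB: "tangent_of \<beta> (fin_pt B) = compl_map A B C -` eline (fin_pt A) (fin_pt C)"
  proof (rule set_eqI)
    fix P
    obtain x y z where P: "nonzero3 x y z" "P = pt x y z" by (rule pt_cases)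
    show "P \<in> tangent_of \<beta> (fin_pt B) \<longleftrightarrow> P \<in> compl_map A B C -` eline (fin_pt A) (fin_pt C)"
      unfolding P(2) tangent_lines[OF P(1)] using P(1) bil
      by (simp add: fin_pt_B pt_in_tangent_of_iff \<beta>_br) linarith
  qed
  have tC: "tangent_of \<beta> (fin_pt C) = compl_map A B C -` eline (fin_pt A) (fin_pt B)"
  proof (rule set_eqI)
    fix P
    obtain x y z where P: "nonzero3 x y z" "P = pt x y z" by (rule pt_cases)
    show "P \<in> tangent_of \<beta> (fin_pt C) \<longleftrightarrow> P \<in> compl_map A B C -` eline (fin_pt A) (fin_pt B)"
      unfolding P(2) tangent_lines[OF P(1)] using P(1) bil
      by (simp add: fin_pt_C pt_in_tangent_of_iff \<beta>_br) linarith
  qed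
  have "{fin_pt B, fin_pt C, fin_pt (midpoint C A), fin_pt (midpoint A B)} \<subseteq> conic_A"
    by (simp add: fin_pt_B fin_pt_C fin_pt_midpoints pt_in_conic_A_iff vertex_form_def)
  then show ?thesis
    unfolding is_conic_A_def using nd conic tB tC by blast
qed

end

theorem theorem2p2:
  fixes A B C :: "real^2"
  assumes "\<not> collinear {A, B, C}"
  shows "(\<exists>!S. is_conic_A A B C S) \<and>
    (\<forall>S. is_conic_A A B C S \<longrightarrow>
      locus_A A B C \<subseteq> S \<and>
      locus_A A B C = S - {fin_pt B, fin_pt C, fin_pt (midpoint C A), fin_pt (midpoint A B)})"
proof -
  interpret triangle A B C using assms by unfold_locales
  have "is_conic_A A B C S \<longleftrightarrow> S = conic_A" for S
    using is_conic_A_unique is_conic_A_conic_A by blast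
  then show ?thesis using locus_A_eq by auto
qed

end
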